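(* Let $\alpha\in\mathbb{C}\setminus\{0\}$, $0<M\leq 1/\log 4$, $\lambda\in\mathbb{D}$ and $z_0\in\mathbb{D}\setminus\{0\}$. Then the boundary $\partial V_2$ of $V_2=V_2(z_0,\lambda)=\{f'(z_0): f\in\mathcal{S}_2(\lambda)\}$ is the Jordan curve given by $$(-\pi,\pi]\ni\theta\mapsto H'_{e^{i\theta},\lambda}(z_0)=\int_0^{z_0}\frac{2M\,\delta(e^{i\theta}\zeta,\lambda)}{1-\delta(e^{i\theta}\zeta,\lambda)\zeta}\,d\zeta+\alpha .$$ Moreover, if $f'(z_0)=H'_{e^{i\theta},\lambda}(z_0)$ for some $f\in\mathcal{S}_2(\lambda)$ and some $\theta\in(-\pi,\pi]$, then $f=H_{e^{i\theta},\lambda}$ on $\mathbb{D}$.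
   Context: $\mathbb{D}=\{z\in\mathbb{C}:|z|<1\}$. For $\alpha\in\mathbb{C}\setminus\{0\}$ and $0<M\le1/\log4$, $\mathcal{P}(\alpha,M)$ is the class of all functions $f$ analytic in $\mathbb{D}$ with $f(0)=0$, $f'(0)=\alpha$ and $\operatorname{Re}(zf''(z))>-M$ for all $z\in\mathbb{D}$. For $\lambda\in\overline{\mathbb{D}}$, $\mathcal{S}_2(\lambda)=\{f\in\mathcal{P}(\alpha,M): f''(0)=2M\lambda\}$. For $\lambda\in\mathbb{D}$, $\delta(z,\lambda)=\dfrac{z+\lambda}{1+\overline{\lambda}z}$. For $|a|\le1$, $\lambda\in\mathbb{D}$ and $z\in\mathbb{D}$, $$H_{a,\lambda}(z)=\int_0^z\left\{\int_0^{\zeta_2}\frac{2M\,\delta(a\zeta_1,\lambda)}{1-\delta(a\zeta_1,\lambda)\zeta_1}\,d\zeta_1\right\}d\zeta_2+\alpha z.$$ *)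

theory Defs
  imports "HOL-Complex_Analysis.Complex_Analysis"
begin

text \<open>Functions on the unit disc are total functions whose values matter only on
  \<open>ball 0 1\<close>.\<close>

definition class_P :: "complex \<Rightarrow> real \<Rightarrow> (complex \<Rightarrow> complex) set" where
  "class_P \<alpha> M = {f. f analytic_on ball 0 1 \<and> f 0 = 0 \<and> deriv f 0 = \<alpha> \<and>
     (\<forall>z\<in>ball 0 1. Re (z * deriv (deriv f) z) > - M)}"

definition class_S2 :: "complex \<Rightarrow> real \<Rightarrow> complex \<Rightarrow> (complex \<Rightarrow> complex) set" where
  "class_S2 \<alpha> M l = {f \<in> class_P \<alpha> M. deriv (deriv f) 0 = 2 * of_real M * l}"

definition V2 :: "complex \<Rightarrow> real \<Rightarrow> complex \<Rightarrow> complex \<Rightarrow> complex set" where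
  "V2 \<alpha> M z0 l = {deriv f z0 |f. f \<in> class_S2 \<alpha> M l}"

definition delta :: "complex \<Rightarrow> complex \<Rightarrow> complex" where
  "delta z l = (z + l) / (1 + cnj l * z)"

definition H_integrand :: "real \<Rightarrow> complex \<Rightarrow> complex \<Rightarrow> complex \<Rightarrow> complex" where
  "H_integrand M a l z = 2 * of_real M * delta (a * z) l / (1 - delta (a * z) l * z)"

text \<open>The integrands are holomorphic on the unit disc when \<open>norm a \<le> 1\<close> and \<open>norm l < 1\<close>,
  so the integrals do not depend on the path; they are taken along straight segments.\<close>

definition H_fun :: "complex \<Rightarrow> real \<Rightarrow> complex \<Rightarrow> complex \<Rightarrow> complex \<Rightarrow> complex" where
  "H_fun \<alpha> M a l z =
     contour_integral (linepath 0 z)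
       (\<lambda>\<zeta>2. contour_integral (linepath 0 \<zeta>2) (H_integrand M a l)) + \<alpha> * z"

end

theory Submission
  imports Defs
begin

text \<open>Write \<open>H\<close> for the extremal function with rotation \<open>a = cis \<theta>\<close>. For each fixed \<open>z\<close> the values \<open>f''(z)\<close>, with \<open>f\<close> in
  the class, fill a closed disc: by two applications of the Schwarz lemma, \<open>f''(z)\<close> is a Moebius
  image of \<open>z \<eta>(z)\<close> where \<open>\<eta>\<close> is an arbitrary holomorphic function bounded by one (\<open>class_S2_second_deriv\<close>).
  The extremal \<open>H''(z)\<close> is the boundary point of this disc with \<open>\<eta> = a\<close>. The outward normal
  there has the argument of \<open>a z / Q(z)\<^sup>2\<close>, where \<open>Q\<close> is the denominator of the kernel. Strict
  convexity of the disc thus says that \<open>(H''(z) - f''(z)) / (a z / Q(z)\<^sup>2)\<close> has positive real part, unless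
  \<open>\<eta>(z) = a\<close> (\<open>Re_chord_pos\<close>).

  This has to be integrated from \<open>0\<close> to \<open>z0\<close>. The primitive of \<open>a z / Q(z)\<^sup>2\<close> has a double zero at the
  origin and is starlike (\<open>starlike_comparison_function\<close>), and a quotient of derivatives with
  positive real part then yields a quotient of functions with positive real part
  (\<open>Re_quotient_pos_of_derivative_quotient\<close>, a form of Libera's lemma). Both facts come from one minimum
  principle, \<open>minimum_principle_Re\<close>. Hence \<open>H'(z0)\<close> lies on a supporting line of the region of
  variability, and any other \<open>f\<close> has \<open>f'(z0)\<close> strictly on one side of it
  (\<open>extremal_function_support\<close>). That gives the uniqueness assertion, the injectivity of the curve
  \<open>\<theta> \<mapsto> H'(z0)\<close> and the fact that the curve runs in the boundary.

  The class is convex, so the region of variability is convex too. By the Jordan curve theorem a simple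
  closed curve contained in the boundary of a planar convex set, and in the set itself, is the whole
  boundary (\<open>frontier_convex_eq_simple_loop\<close>).\<close>

section \<open>A minimum principle and integrals of quotients of positive real part\<close>

text \<open>At a minimum point \<open>w\<close> of \<open>Re p\<close> on a closed disc about the origin, the curve
  \<open>t \<mapsto> w * exp (- \<nu> w * t)\<close> stays in that disc for \<open>t \<ge> 0\<close>, because \<open>Re (\<nu> w) \<ge> 0\<close>. So the derivative of
  \<open>Re p\<close> along it is nonnegative at \<open>t = 0\<close>, that is \<open>Re (\<nu> w * (w * deriv p w)) \<le> 0\<close>. This is the idea of the
  Jack--Miller--Mocanu lemma.\<close>
lemma minimum_principle_Re:
  fixes p \<nu> :: "complex \<Rightarrow> complex"
  assumes p: "p holomorphic_on ball 0 1"
    and \<nu>: "\<And>w. w \<in> ball 0 1 \<Longrightarrow> 0 \<le> Re (\<nu> w)"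
    and z: "z \<in> ball 0 1"
  shows "\<exists>w\<in>ball 0 1. Re (p w + \<nu> w * (w * deriv p w)) \<le> Re (p z)"
proof -
  have sub: "cball 0 (norm z) \<subseteq> ball (0::complex) 1"
    using z by auto
  have "continuous_on (cball 0 (norm z)) (\<lambda>w. Re (p w))"
    using holomorphic_on_imp_continuous_on[OF p] continuous_on_subset[OF _ sub]
    by (intro continuous_intros) auto
  then obtain w where w: "w \<in> cball 0 (norm z)"
    and min: "\<And>y. y \<in> cball 0 (norm z) \<Longrightarrow> Re (p w) \<le> Re (p y)"
    using continuous_attains_inf[of "cball 0 (norm z)" "\<lambda>w. Re (p w)"] by auto
  have wb: "w \<in> ball 0 1" using w sub by blast
  \<comment> \<open>\<open>Re p\<close> along the curve from the minimum point that stays in the closed disc.\<close>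
  define u where "u t = Re (p (w * exp (- \<nu> w * of_real t)))" for t :: real
  have pw: "(p has_field_derivative deriv p w) (at w)"
    using holomorphic_derivI[OF p open_ball wb] .
  have e: "((\<lambda>t. w * exp (- \<nu> w * t)) has_field_derivative (- \<nu> w * w)) (at (of_real 0))"
    by (auto intro!: derivative_eq_intros)
  have "((\<lambda>t. p (w * exp (- \<nu> w * t))) has_field_derivative (deriv p w * (- \<nu> w * w)))
          (at (of_real 0))"
    using DERIV_chain2[OF _ e, of p "deriv p w"] pw by simp
  then have du: "(u has_real_derivative Re (deriv p w * (- \<nu> w * w))) (at 0)"
    unfolding u_def by (intro has_field_derivative_Re has_vector_derivative_real_field)
  have "0 \<le> Re (deriv p w * (- \<nu> w * w))"
  proof (rule ccontr)
    assume "\<not> ?thesis"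
    then obtain d where d: "d > 0" "\<And>h. 0 < h \<Longrightarrow> h < d \<Longrightarrow> u (0 + h) < u 0"
      using DERIV_neg_dec_right[OF du] by auto
    have "norm (w * exp (- \<nu> w * of_real (d/2))) \<le> norm w * 1"
      using \<nu>[OF wb] d(1) unfolding norm_mult by (intro mult_left_mono) auto
    then have "Re (p w) \<le> u (d/2)"
      unfolding u_def using w by (intro min) auto
    moreover have "u (d/2) < u 0" using d(2)[of "d/2"] d(1) by simp
    ultimately show False by (simp add: u_def)
  qed
  then have "Re (p w + \<nu> w * (w * deriv p w)) \<le> Re (p w)"
    by (simp add: algebra_simps)
  also have "\<dots> \<le> Re (p z)" by (rule min) simp
  finally show ?thesis using wb by blast
qed

text \<open>A form of Libera's lemma. The functions compared are \<open>z\<^sup>2 P\<close> and \<open>z\<^sup>2 G\<close>; a factor \<open>z\<close> has been removed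
  from their derivatives, so that no division by zero occurs at the origin. The second hypothesis
  says that the quotient of the derivatives has positive real part, the first one that \<open>z\<^sup>2 G\<close> is
  starlike. With \<open>p = P / G\<close> the quotient of the derivatives is \<open>p + \<nu> z p'\<close> for
  \<open>\<nu> = G / (2 G + z G')\<close>, so the minimum principle gives the conclusion. The classical proof integrates
  along the curve that \<open>z\<^sup>2 G\<close> maps to a line segment; the minimum principle avoids constructing it.\<close>
lemma Re_quotient_pos_of_derivative_quotient:
  fixes G P :: "complex \<Rightarrow> complex"
  assumes G: "G holomorphic_on ball 0 1" and P: "P holomorphic_on ball 0 1"
    and G': "\<And>w. w \<in> ball 0 1 \<Longrightarrow> 0 < Re (G w / (2 * G w + w * deriv G w))"
    and P': "\<And>w. w \<in> ball 0 1 \<Longrightarrow>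
               0 < Re ((2 * P w + w * deriv P w) / (2 * G w + w * deriv G w))"
    and z: "z \<in> ball 0 1"
  shows "0 < Re (P z / G z)"
proof -
  have Gnz: "G w \<noteq> 0" "2 * G w + w * deriv G w \<noteq> 0" if "w \<in> ball 0 1" for w
    using G'[OF that] by auto
  have q: "(\<lambda>w. P w / G w) holomorphic_on ball 0 1"
    using G P Gnz(1) by (intro holomorphic_intros) auto
  have "\<exists>w\<in>ball 0 1. Re (P w / G w + G w / (2 * G w + w * deriv G w) * (w * deriv (\<lambda>w. P w / G w) w))
          \<le> Re (P z / G z)"
    by (rule minimum_principle_Re[OF q _ z]) (use G' in \<open>auto intro: less_imp_le\<close>)
  then obtain w where w: "w \<in> ball 0 1"
    and le: "Re (P w / G w + G w / (2 * G w + w * deriv G w) * (w * deriv (\<lambda>w. P w / G w) w))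
             \<le> Re (P z / G z)"
    by blast
  have "deriv (\<lambda>w. P w / G w) w = (deriv P w * G w - P w * deriv G w) / (G w * G w)"
    using holomorphic_derivI[OF G open_ball w] holomorphic_derivI[OF P open_ball w] Gnz(1)[OF w]
    by (intro DERIV_imp_deriv DERIV_divide) auto
  moreover have "p / g + g / s * (w * ((dp * g - p * dg) / (g * g))) = (2 * p + w * dp) / s"
    if "g \<noteq> 0" "s \<noteq> 0" "s = 2 * g + w * dg" for p g dp dg s :: complex
  proof -
    have "p / g + g / s * (w * ((dp * g - p * dg) / (g * g)))
        = (p * s + w * (dp * g - p * dg)) / (g * s)"
      using that(1,2) by (simp add: divide_simps)
    also have "p * s + w * (dp * g - p * dg) = g * (2 * p + w * dp)"
      unfolding that(3) by (simp add: algebra_simps)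
    finally show ?thesis using that(1) by simp
  qed
  ultimately have "P w / G w + G w / (2 * G w + w * deriv G w) * (w * deriv (\<lambda>w. P w / G w) w)
      = (2 * P w + w * deriv P w) / (2 * G w + w * deriv G w)"
    using Gnz[OF w] by simp
  then show ?thesis using le P'[OF w] by simp
qed

text \<open>At the origin the identity follows by comparing the derivatives of both products.\<close>
lemma holomorphic_cancel_factor_z:
  fixes u v :: "complex \<Rightarrow> complex"
  assumes u: "u holomorphic_on ball 0 1" and v: "v holomorphic_on ball 0 1"
    and eq: "\<And>z. z \<in> ball 0 1 \<Longrightarrow> z * u z = z * v z"
    and z: "z \<in> ball 0 1"
  shows "u z = v z"
proof (cases "z = 0")
  case False
  then show ?thesis using eq[OF z] by simp
next
  case True
  have 0: "(0::complex) \<in> ball 0 1" by simp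
  have D: "((\<lambda>z. z * h z) has_field_derivative h 0) (at 0)" if "h holomorphic_on ball 0 1" for h
    using DERIV_mult[OF DERIV_ident holomorphic_derivI[OF that open_ball 0]] by simp
  have "((\<lambda>z. z * v z) has_field_derivative u 0) (at 0)"
    by (rule has_field_derivative_transform_within_open[OF D[OF u] open_ball 0 eq]) auto
  then show ?thesis using D[OF v] DERIV_unique True by blast
qed

lemma double_zero_factorization:
  fixes P s :: "complex \<Rightarrow> complex"
  assumes P: "\<And>z. z \<in> ball 0 1 \<Longrightarrow> (P has_field_derivative z * s z) (at z)"
    and P0: "P 0 = 0" and s: "s holomorphic_on ball 0 1"
  shows "\<exists>R. R holomorphic_on ball 0 1 \<and>
           (\<forall>z\<in>ball 0 1. P z = z\<^sup>2 * R z \<and> 2 * R z + z * deriv R z = s z)"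
proof -
  have Ph: "P holomorphic_on ball 0 1"
    using P unfolding holomorphic_on_open[OF open_ball] by blast
  obtain h where h: "h holomorphic_on ball 0 1" "\<And>z. norm z < 1 \<Longrightarrow> P z = z * h z" "deriv P 0 = h 0"
    using Schwarz3[OF Ph P0] by blast
  have "deriv P 0 = 0" using DERIV_imp_deriv[OF P[of 0]] by simp
  then have "h 0 = 0" using h(3) by simp
  then obtain R where R: "R holomorphic_on ball 0 1" "\<And>z. norm z < 1 \<Longrightarrow> h z = z * R z"
    using Schwarz3[OF h(1)] by blast
  have PR: "P z = z\<^sup>2 * R z" if "z \<in> ball 0 1" for z
    using h(2)[of z] R(2)[of z] that by (simp add: power2_eq_square)
  have "2 * R z + z * deriv R z = s z" if z: "z \<in> ball 0 1" for z
  proof (rule holomorphic_cancel_factor_z[OF _ s _ z])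
    show "(\<lambda>z. 2 * R z + z * deriv R z) holomorphic_on ball 0 1"
      using R(1) by (intro holomorphic_intros) auto
    fix z :: complex assume z: "z \<in> ball 0 1"
    have "((\<lambda>z. z\<^sup>2 * R z) has_field_derivative z * (2 * R z + z * deriv R z)) (at z)"
      using holomorphic_derivI[OF R(1) open_ball z]
      by (auto intro!: derivative_eq_intros simp: power2_eq_square algebra_simps)
    moreover have "((\<lambda>z. z\<^sup>2 * R z) has_field_derivative z * s z) (at z)"
      by (rule has_field_derivative_transform_within_open[OF P[OF z] open_ball z PR]) auto
    ultimately show "z * (2 * R z + z * deriv R z) = z * s z"
      using DERIV_unique by blast
  qed
  then show ?thesis using R(1) PR by blast
qed

section \<open>The Moebius kernel\<close>

text \<open>The denominator that remains when \<open>delta w l\<close> is inserted into \<open>\<delta> / (1 - \<delta> z)\<close> and the fractions are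
  cleared; as a function of \<open>w\<close> it is affine, which exhibits the kernel as a Moebius map of \<open>w\<close>.\<close>
definition kernel_denom :: "complex \<Rightarrow> complex \<Rightarrow> complex \<Rightarrow> complex" where
  "kernel_denom l z w = 1 - l * z + (cnj l - z) * w"

lemma Re_divide_pos:
  assumes "0 < Re (x * cnj y)"
  shows "0 < Re (x / y)"
proof -
  have "y \<noteq> 0" using assms by auto
  then have "0 < Re (x * cnj y) / (norm y)\<^sup>2" using assms by simp
  also have "\<dots> = Re (x / y)" by (subst complex_div_cnj) (simp add: Re_divide_of_real flip: of_real_power)
  finally show ?thesis .
qed

lemma norm_kernel_coeff_less:
  assumes "norm l < 1" "norm z < 1"
  shows "norm (cnj l - z) < norm (1 - l * z)"
proof -
  have "(norm (1 - l * z))\<^sup>2 - (norm (cnj l - z))\<^sup>2 = (1 - (norm l)\<^sup>2) * (1 - (norm z)\<^sup>2)"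
    unfolding cmod_power2 by (simp add: power2_eq_square algebra_simps)
  also have "\<dots> > 0"
    using assms by (intro mult_pos_pos) (auto simp: power_less_one_iff)
  finally show ?thesis
    by (simp add: power2_less_imp_less)
qed

lemma kernel_denom_nonzero:
  assumes "norm l < 1" "norm z < 1" "norm w \<le> 1"
  shows "kernel_denom l z w \<noteq> 0"
proof
  assume "kernel_denom l z w = 0"
  then have "1 - l * z = - ((cnj l - z) * w)"
    by (simp add: kernel_denom_def eq_neg_iff_add_eq_0)
  then have "norm (1 - l * z) = norm (cnj l - z) * norm w"
    by (simp add: norm_mult)
  also have "\<dots> \<le> norm (cnj l - z) * 1"
    using assms(3) by (intro mult_left_mono) auto
  finally show False using norm_kernel_coeff_less[OF assms(1,2)] by simp
qed

lemma moebius_denom_nonzero: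
  fixes l w :: complex
  assumes "norm l < 1" "norm w < 1"
  shows "1 + cnj l * w \<noteq> 0" "1 - cnj l * w \<noteq> 0"
proof -
  have "norm (cnj l * w) < 1"
    using mult_strict_mono'[of "norm l" 1 "norm w" 1] assms by (simp add: norm_mult)
  then have "cnj l * w \<noteq> - 1" "cnj l * w \<noteq> 1" by auto
  then show "1 + cnj l * w \<noteq> 0" "1 - cnj l * w \<noteq> 0"
    by (auto simp: add_eq_0_iff)
qed

lemma delta_kernel:
  assumes "norm l < 1" "norm z < 1" "norm w < 1"
  shows "2 * of_real M * delta w l / (1 - delta w l * z)
       = 2 * of_real M * (w + l) / kernel_denom l z w"
proof -
  have nz: "1 + cnj l * w \<noteq> 0" using moebius_denom_nonzero[OF assms(1,3)] by simp
  have "1 - delta w l * z = kernel_denom l z w / (1 + cnj l * w)"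
    using nz unfolding delta_def kernel_denom_def by (simp add: divide_simps) (simp add: algebra_simps)
  then show ?thesis using nz by (simp add: delta_def)
qed

text \<open>For a Moebius map the difference of two values of the kernel is the difference of
  the arguments times the determinant, over both denominators.\<close>
lemma kernel_difference:
  assumes "kernel_denom l z (z * u) \<noteq> 0" "kernel_denom l z (z * v) \<noteq> 0"
  shows "2 * of_real M * (z * u + l) / kernel_denom l z (z * u)
           - 2 * of_real M * (z * v + l) / kernel_denom l z (z * v)
       = z * (of_real (2 * M * (1 - (norm l)\<^sup>2)) * (u - v)
               / (kernel_denom l z (z * u) * kernel_denom l z (z * v)))"
proof -
  have "(z * u + l) * kernel_denom l z (z * v) - (z * v + l) * kernel_denom l z (z * u)
      = z * ((1 - l * cnj l) * (u - v))"
    unfolding kernel_denom_def by (simp add: algebra_simps)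
  also have "1 - l * cnj l = of_real (1 - (norm l)\<^sup>2)"
    by (simp only: complex_norm_square of_real_diff of_real_1)
  finally have n: "(z * u + l) * kernel_denom l z (z * v) - (z * v + l) * kernel_denom l z (z * u)
      = z * (of_real (1 - (norm l)\<^sup>2) * (u - v))" .
  have "2 * of_real M * (z * u + l) / kernel_denom l z (z * u)
           - 2 * of_real M * (z * v + l) / kernel_denom l z (z * v)
      = 2 * of_real M * ((z * u + l) * kernel_denom l z (z * v) - (z * v + l) * kernel_denom l z (z * u))
          / (kernel_denom l z (z * u) * kernel_denom l z (z * v))"
    using assms by (simp add: diff_frac_eq) (simp add: algebra_simps)
  then show ?thesis unfolding n by (simp add: algebra_simps)
qed

lemma norm_delta_less_1:
  assumes "norm l < 1" "norm w < 1"
  shows "norm (delta w l) < 1"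
proof -
  have "norm (w + l) < norm (1 + cnj l * w)"
    using norm_kernel_coeff_less[of "- cnj l" w] assms
    by (simp add: norm_minus_commute add.commute)
  then show ?thesis unfolding delta_def norm_divide
    using moebius_denom_nonzero[OF assms] by simp
qed

text \<open>This is the strict convexity of a disc: up to a positive factor the expression is the inner
  product of the outward normal at a boundary point of the disc parametrized by
  \<open>\<omega>\<close> with the chord from the point \<open>\<omega>\<close> to that boundary point.\<close>
lemma Re_chord_pos:
  fixes X Y \<omega> :: complex
  assumes XY: "norm Y < norm X" and \<omega>: "norm \<omega> \<le> 1" "\<omega> \<noteq> 1"
  shows "0 < Re ((1 - \<omega>) * (X + Y) / (X + Y * \<omega>))"
proof -
  have pos: "0 < (norm X)\<^sup>2 - (norm Y)\<^sup>2" "0 \<le> 1 - (norm \<omega>)\<^sup>2"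
    using XY \<omega>(1) by (auto simp: power_strict_mono power_le_one)
  have "2 * Re ((1 - \<omega>) * (X + Y) * cnj (X + Y * \<omega>))
      = ((norm X)\<^sup>2 - (norm Y)\<^sup>2) * (norm (1 - \<omega>))\<^sup>2 + (1 - (norm \<omega>)\<^sup>2) * (norm (X + Y))\<^sup>2"
    unfolding cmod_power2 by (simp add: power2_eq_square algebra_simps)
  also have "\<dots> > 0"
    using pos \<omega>(2) by (intro add_pos_nonneg mult_pos_pos mult_nonneg_nonneg) auto
  finally show ?thesis by (intro Re_divide_pos) simp
qed

text \<open>Write \<open>Q z\<close> for the numerator. Then \<open>Q z - z * Q' z = 1 + a * z\<^sup>2\<close>, so the logarithmic derivative of
  \<open>z\<^sup>2 / (Q z)\<^sup>2\<close>, multiplied by \<open>z\<close>, is twice the reciprocal of the quotient considered here: the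
  lemma says that \<open>z\<^sup>2 / (Q z)\<^sup>2\<close> is starlike. After multiplication by the conjugate of \<open>1 + a * z\<^sup>2\<close> the real part
  factors as \<open>(1 - \<bar>z\<bar>\<^sup>2) (1 + \<bar>z\<bar>\<^sup>2 + Re (b * z))\<close>,
  where \<open>b = cnj l * a - l\<close> has modulus at most 2.\<close>
lemma Re_starlike_kernel_pos:
  fixes a l z :: complex
  assumes a: "norm a = 1" and l: "norm l < 1" and z: "norm z < 1"
  shows "0 < Re (kernel_denom l z (a * z) / (1 + a * z\<^sup>2))"
proof -
  define b where "b = cnj l * a - l"
  have Q: "kernel_denom l z (a * z) = 1 + b * z - a * z\<^sup>2"
    by (simp add: kernel_denom_def b_def power2_eq_square algebra_simps)
  have aa: "a * cnj a = 1" using a by (simp add: complex_norm_square[symmetric])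
  have b_cnj: "b * cnj a = - cnj b"
  proof -
    have "b * cnj a = cnj l * (a * cnj a) - l * cnj a" by (simp add: b_def algebra_simps)
    then show ?thesis by (simp add: aa b_def)
  qed
  have "norm b \<le> norm (cnj l * a) + norm l"
    unfolding b_def by (rule norm_triangle_ineq4)
  then have "norm b \<le> 2" using l a by (simp add: norm_mult)
  then have "norm (b * z) \<le> 2 * norm z"
    by (simp add: norm_mult mult_right_mono)
  then have Rb: "Re (b * z) \<ge> - 2 * norm z"
    using abs_Re_le_cmod[of "b * z"] by linarith
  have zz: "z * cnj z = of_real ((norm z)\<^sup>2)" by (rule complex_norm_square[symmetric])
  have "(1 + b * z - a * z\<^sup>2) * cnj (1 + a * z\<^sup>2)
      = 1 - (a * cnj a) * (z * cnj z)\<^sup>2 + b * z + (b * cnj a) * cnj z * (z * cnj z)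
        + (cnj (a * z\<^sup>2) - a * z\<^sup>2)"
    by (simp add: power2_eq_square algebra_simps)
  also have "\<dots> = 1 - (of_real ((norm z)\<^sup>2))\<^sup>2 + b * z - cnj (b * z) * of_real ((norm z)\<^sup>2)
        + (cnj (a * z\<^sup>2) - a * z\<^sup>2)"
    unfolding aa zz b_cnj by simp
  also have "Re \<dots> = (1 - (norm z)\<^sup>2) * (1 + (norm z)\<^sup>2 + Re (b * z))"
    by (simp add: power2_eq_square algebra_simps flip: of_real_mult)
  also have "\<dots> > 0"
  proof (intro mult_pos_pos)
    show "0 < 1 - (norm z)\<^sup>2" using z by (simp add: power_less_one_iff)
    have "0 < (1 - norm z)\<^sup>2" using z by simp
    then show "0 < 1 + (norm z)\<^sup>2 + Re (b * z)" using Rb by (simp add: power2_eq_square algebra_simps)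
  qed
  finally have num: "0 < Re ((1 + b * z - a * z\<^sup>2) * cnj (1 + a * z\<^sup>2))" .
  then have "0 < Re ((1 + b * z - a * z\<^sup>2) / (1 + a * z\<^sup>2))"
    by (rule Re_divide_pos)
  then show ?thesis by (simp add: Q)
qed

section \<open>A starlike comparison function\<close>

text \<open>With \<open>Q z = kernel_denom l z (a * z)\<close>, the function \<open>z\<^sup>2 G\<close> is the primitive of
  \<open>a * z / (Q z)\<^sup>2\<close>. That derivative points in the direction of the outward normal, at the extremal
  value, of the disc of possible values of \<open>f''(z)\<close>. Its starlikeness
  is derived by comparing it with \<open>z\<^sup>2 N = a * z\<^sup>2 / (Q z)\<^sup>2\<close>: both the quotient of their derivatives
  and the quantity that makes \<open>z\<^sup>2 N\<close> starlike are \<open>Q z / (2 (1 + a * z\<^sup>2))\<close>.\<close>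
lemma starlike_comparison_function:
  fixes a l :: complex
  assumes a: "norm a = 1" and l: "norm l < 1"
  obtains G where "G holomorphic_on ball 0 1"
    "\<And>z. z \<in> ball 0 1 \<Longrightarrow> 2 * G z + z * deriv G z = a / (kernel_denom l z (a * z))\<^sup>2"
    "\<And>z. z \<in> ball 0 1 \<Longrightarrow> 0 < Re (G z / (a / (kernel_denom l z (a * z))\<^sup>2))"
proof -
  define Q where "Q z = kernel_denom l z (a * z)" for z
  define N where "N z = a / (Q z)\<^sup>2" for z
  have Qnz: "Q z \<noteq> 0" if "z \<in> ball 0 1" for z
    unfolding Q_def using that a l by (intro kernel_denom_nonzero) (auto simp: norm_mult)
  have Qh: "Q holomorphic_on ball 0 1"
    unfolding Q_def kernel_denom_def by (intro holomorphic_intros)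
  have Nh: "N holomorphic_on ball 0 1"
    unfolding N_def using Qh Qnz by (intro holomorphic_intros) auto
  have anz: "a \<noteq> 0" using a by auto
  have Nnz: "N z \<noteq> 0" if "z \<in> ball 0 1" for z
    using Qnz[OF that] anz by (simp add: N_def)
  have "(\<lambda>z. z * N z) holomorphic_on ball 0 1"
    using Nh by (intro holomorphic_intros)
  then obtain G1 where G1:
      "\<And>z. z \<in> ball 0 1 \<Longrightarrow> (G1 has_field_derivative z * N z) (at z within ball 0 1)"
    using holomorphic_convex_primitive'[OF convex_ball open_ball] by blast
  define G0 where "G0 z = G1 z - G1 0" for z
  have dG0: "(G0 has_field_derivative z * N z) (at z)" if "z \<in> ball 0 1" for z
    using G1[OF that] that at_within_open[OF that open_ball] unfolding G0_def
    by (auto intro!: derivative_eq_intros)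
  have G00: "G0 0 = 0" by (simp add: G0_def)
  have "\<exists>G. G holomorphic_on ball 0 1 \<and>
          (\<forall>z\<in>ball 0 1. G0 z = z\<^sup>2 * G z \<and> 2 * G z + z * deriv G z = N z)"
    by (rule double_zero_factorization[of G0 N]) (use dG0 G00 Nh in auto)
  then obtain G
    where G: "G holomorphic_on ball 0 1"
      and G_eq: "\<forall>z\<in>ball 0 1. G0 z = z\<^sup>2 * G z \<and> 2 * G z + z * deriv G z = N z"
    by (elim exE conjE)
  \<comment> \<open>For \<open>z\<^sup>2 N\<close> the derivative, divided by \<open>z\<close>, is \<open>2 N + z N'\<close>; the bracket is twice the reciprocal
    of the quotient treated in \<open>Re_starlike_kernel_pos\<close>.\<close>
  have N_eq: "2 * N z + z * deriv N z = N z * (2 * (1 + a * z\<^sup>2) / Q z)"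
    if z: "z \<in> ball 0 1" for z
  proof -
    have dQ: "(Q has_field_derivative (cnj l * a - l - 2 * a * z)) (at z)"
      unfolding Q_def kernel_denom_def
      by (auto intro!: derivative_eq_intros simp: algebra_simps)
    have "((\<lambda>z. (Q z)\<^sup>2) has_field_derivative 2 * Q z * (cnj l * a - l - 2 * a * z)) (at z)"
      using DERIV_power[OF dQ, of 2] by (simp add: ac_simps)
    from DERIV_divide[OF DERIV_const this, of a] Qnz[OF z]
    have dN: "deriv N z = - (a * (2 * Q z * (cnj l * a - l - 2 * a * z))) / ((Q z)\<^sup>2 * (Q z)\<^sup>2)"
      unfolding N_def by (intro DERIV_imp_deriv) simp
    have "Q z - z * (cnj l * a - l - 2 * a * z) = 1 + a * z\<^sup>2"
      by (simp add: Q_def kernel_denom_def power2_eq_square algebra_simps)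
    moreover have "2 * N z + z * deriv N z
        = N z * (2 * (Q z - z * (cnj l * a - l - 2 * a * z)) / Q z)"
    proof -
      have "2 * (a / q\<^sup>2) + z * (- (a * (2 * q * d)) / (q\<^sup>2 * q\<^sup>2)) = a / q\<^sup>2 * (2 * (q - z * d) / q)"
        if "q \<noteq> 0" for q d :: complex
        using that by (simp add: divide_simps power2_eq_square) (simp add: algebra_simps)
      from this[OF Qnz[OF z]] show ?thesis unfolding dN N_def .
    qed
    ultimately show ?thesis by simp
  qed
  have pos: "0 < Re (N z / (2 * N z + z * deriv N z))" if z: "z \<in> ball 0 1" for z
  proof -
    have "N z / (2 * N z + z * deriv N z) = (Q z / (1 + a * z\<^sup>2)) / 2"
      unfolding N_eq[OF z] using Nnz[OF z] by simp
    then have "Re (N z / (2 * N z + z * deriv N z)) = Re (Q z / (1 + a * z\<^sup>2)) / 2"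
      by (simp only: Re_divide_numeral)
    then show ?thesis
      using Re_starlike_kernel_pos[OF a l, of z] z unfolding Q_def by simp
  qed
  have "0 < Re (G z / N z)" if "z \<in> ball 0 1" for z
    using Re_quotient_pos_of_derivative_quotient[OF Nh G pos _ that] pos G_eq by simp
  then show ?thesis
    using that[OF G] G_eq unfolding N_def Q_def by simp
qed

section \<open>The second derivatives of the functions in the class\<close>

text \<open>For functions built from explicit primitives this replaces the iterated \<open>deriv\<close> in the definition of the class
  by the given derivatives, which are known only on the disc.\<close>
lemma class_S2_iff_primitives:
  assumes f: "\<And>z. z \<in> ball 0 1 \<Longrightarrow> (f has_field_derivative f' z) (at z)"
    and f': "\<And>z. z \<in> ball 0 1 \<Longrightarrow> (f' has_field_derivative f'' z) (at z)"
  shows "f \<in> class_S2 \<alpha> M l \<longleftrightarrow> f 0 = 0 \<and> f' 0 = \<alpha> \<and> f'' 0 = 2 * of_real M * l \<and>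
           (\<forall>z\<in>ball 0 1. Re (z * f'' z) > - M)"
    and "z \<in> ball 0 1 \<Longrightarrow> deriv f z = f' z"
    and "z \<in> ball 0 1 \<Longrightarrow> deriv (deriv f) z = f'' z"
proof -
  have d1: "deriv f z = f' z" if "z \<in> ball 0 1" for z
    using f[OF that] by (rule DERIV_imp_deriv)
  have d2: "deriv (deriv f) z = f'' z" if "z \<in> ball 0 1" for z
    by (rule DERIV_imp_deriv, rule has_field_derivative_transform_within_open[OF f'[OF that] open_ball that])
       (simp add: d1)
  have "f holomorphic_on ball 0 1"
    unfolding holomorphic_on_open[OF open_ball] using f by blast
  then have "f analytic_on ball 0 1"
    by (simp add: analytic_on_open)
  then show "f \<in> class_S2 \<alpha> M l \<longleftrightarrow> f 0 = 0 \<and> f' 0 = \<alpha> \<and> f'' 0 = 2 * of_real M * l \<and>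
           (\<forall>z\<in>ball 0 1. Re (z * f'' z) > - M)"
    unfolding class_S2_def class_P_def using d1 d2 by auto
  show "z \<in> ball 0 1 \<Longrightarrow> deriv f z = f' z" "z \<in> ball 0 1 \<Longrightarrow> deriv (deriv f) z = f'' z"
    using d1 d2 by auto
qed

lemma class_S2_derivs:
  assumes "f \<in> class_S2 \<alpha> M l" "z \<in> ball 0 1"
  shows "(f has_field_derivative deriv f z) (at z)"
    and "(deriv f has_field_derivative deriv (deriv f) z) (at z)"
proof -
  have h: "f holomorphic_on ball 0 1"
    using assms(1) by (simp add: class_S2_def class_P_def analytic_on_open)
  then show "(f has_field_derivative deriv f z) (at z)"
    "(deriv f has_field_derivative deriv (deriv f) z) (at z)"
    using assms(2) by (auto intro!: holomorphic_derivI[OF _ open_ball] holomorphic_deriv)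
qed

text \<open>The Schwarz lemma for the quotient \<open>f z / z\<close>, including its value at the origin and with the equality
  case as an alternative.\<close>
lemma Schwarz_quotient:
  fixes f :: "complex \<Rightarrow> complex"
  assumes f: "f holomorphic_on ball 0 1" and f0: "f 0 = 0"
    and less: "\<And>z. norm z < 1 \<Longrightarrow> norm (f z) < 1"
  shows "\<exists>h. h holomorphic_on ball 0 1 \<and> (\<forall>z\<in>ball 0 1. f z = z * h z) \<and>
           ((\<forall>z\<in>ball 0 1. norm (h z) < 1) \<or> (\<exists>c. norm c = 1 \<and> (\<forall>z\<in>ball 0 1. h z = c)))"
proof -
  obtain h where h: "h holomorphic_on ball 0 1" "\<And>z. norm z < 1 \<Longrightarrow> f z = z * h z" "deriv f 0 = h 0"
    using Schwarz3[OF f f0] by blast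
  have "\<exists>c. norm c = 1 \<and> (\<forall>z\<in>ball 0 1. h z = c)"
    if z: "z \<in> ball 0 1" and not: "\<not> norm (h z) < 1" for z
  proof -
    have "(\<exists>z. norm z < 1 \<and> z \<noteq> 0 \<and> norm (f z) = norm z) \<or> norm (deriv f 0) = 1"
    proof (cases "z = 0")
      case True
      then show ?thesis using Schwarz_Lemma(2)[OF f f0 less z[simplified]] not h(3) by auto
    next
      case False
      have "norm (f z) \<le> norm z" using Schwarz_Lemma(1)[OF f f0 less] z by simp
      moreover have "norm z * 1 \<le> norm z * norm (h z)" using not by (intro mult_left_mono) auto
      ultimately have "norm (f z) = norm z" using h(2)[of z] z by (simp add: norm_mult)
      then show ?thesis using False z by auto
    qed
    then obtain c where c: "\<And>z. norm z < 1 \<Longrightarrow> f z = c * z" "norm c = 1"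
      using Schwarz_Lemma(3)[OF f f0 less z[simplified]] by blast
    have "h z = c" if "z \<in> ball 0 1" for z
    proof (rule holomorphic_cancel_factor_z[OF h(1) _ _ that])
      show "(\<lambda>z. c) holomorphic_on ball 0 1" by (rule holomorphic_on_const)
      show "z * h z = z * c" if "z \<in> ball 0 1" for z
        using c(1)[of z] h(2)[of z] that by (simp add: mult.commute)
    qed
    then show ?thesis using c(2) by blast
  qed
  then show ?thesis using h(1,2) by (intro exI[of _ h]) force
qed

text \<open>The half-plane condition says that \<open>z f''(z) = 2 M \<omega> / (1 - \<omega>)\<close> with \<open>\<omega>\<close> a self-map of the disc fixing the
  origin. By Schwarz \<open>\<omega> = z \<phi>\<close>, where \<open>\<phi> 0 = l\<close>; a Moebius map moves \<open>l\<close> to the origin, and a second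
  application of Schwarz leaves a free function \<open>\<eta>\<close> bounded by one. The extremal functions are those with
  \<open>\<eta>\<close> a unimodular constant.\<close>
lemma class_S2_second_deriv:
  assumes f: "f \<in> class_S2 \<alpha> M l" and M: "0 < M" and l: "norm l < 1"
  shows "\<exists>\<eta>. \<eta> holomorphic_on ball 0 1 \<and>
     ((\<forall>z\<in>ball 0 1. norm (\<eta> z) < 1) \<or> (\<exists>c. norm c = 1 \<and> (\<forall>z\<in>ball 0 1. \<eta> z = c))) \<and>
     (\<forall>z\<in>ball 0 1. deriv (deriv f) z
        = 2 * of_real M * (z * \<eta> z + l) / kernel_denom l z (z * \<eta> z))"
proof -
  define g where "g = deriv (deriv f)"
  have fh: "f holomorphic_on ball 0 1"
    using f by (simp add: class_S2_def class_P_def analytic_on_open)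
  have gh: "g holomorphic_on ball 0 1"
    unfolding g_def by (intro holomorphic_deriv fh open_ball)
  have g0: "g 0 = 2 * of_real M * l" and gRe: "\<And>z. norm z < 1 \<Longrightarrow> Re (z * g z) > - M"
    using f by (auto simp: class_S2_def class_P_def g_def)
  \<comment> \<open>Solving \<open>z g = 2 M \<omega> / (1 - \<omega>)\<close> for \<open>\<omega>\<close> gives \<open>\<omega> = z g / W\<close>.\<close>
  define W where "W z = 2 * of_real M + z * g z" for z
  have Wnz: "W z \<noteq> 0" if "norm z < 1" for z
  proof -
    have "Re (W z) > 0" using gRe[OF that] M by (simp add: W_def)
    then show ?thesis by auto
  qed
  have Wh: "W holomorphic_on ball 0 1"
    unfolding W_def using gh by (intro holomorphic_intros)
  have "norm (z * g z / W z) < 1" if z: "norm z < 1" for z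
  proof -
    have "(norm (W z))\<^sup>2 - (norm (z * g z))\<^sup>2 = 4 * M * (M + Re (z * g z))"
      unfolding cmod_power2 W_def by (simp add: power2_eq_square algebra_simps)
    also have "\<dots> > 0" using gRe[OF z] M by (intro mult_pos_pos) auto
    finally have "norm (z * g z) < norm (W z)" by (simp add: power2_less_imp_less)
    then show ?thesis using Wnz[OF z] by (simp add: norm_divide)
  qed
  moreover have "(\<lambda>z. z * g z / W z) holomorphic_on ball 0 1"
    using gh Wh Wnz by (intro holomorphic_intros) auto
  ultimately obtain \<phi> where \<phi>: "\<phi> holomorphic_on ball 0 1"
      "\<forall>z\<in>ball 0 1. z * g z / W z = z * \<phi> z"
      "(\<forall>z\<in>ball 0 1. norm (\<phi> z) < 1) \<or> (\<exists>c. norm c = 1 \<and> (\<forall>z\<in>ball 0 1. \<phi> z = c))"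
    using Schwarz_quotient[of "\<lambda>z. z * g z / W z"] by auto
  have \<phi>g: "g z / W z = \<phi> z" if "z \<in> ball 0 1" for z
  proof (rule holomorphic_cancel_factor_z[OF _ \<phi>(1) _ that])
    show "(\<lambda>z. g z / W z) holomorphic_on ball 0 1"
      using gh Wh Wnz by (intro holomorphic_intros) auto
    show "z * (g z / W z) = z * \<phi> z" if "z \<in> ball 0 1" for z
      using \<phi>(2) that by simp
  qed
  have \<phi>0: "\<phi> 0 = l" using \<phi>g[of 0] M by (simp add: W_def g0)
  have \<phi>1: "norm (\<phi> z) < 1" if "norm z < 1" for z
  proof -
    have "\<not> (\<exists>c. norm c = 1 \<and> (\<forall>z\<in>ball 0 1. \<phi> z = c))"
      using \<phi>0 l by force
    then show ?thesis using \<phi>(3) that by auto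
  qed
  define \<psi> where "\<psi> z = (\<phi> z - l) / (1 - cnj l * \<phi> z)" for z
  have dnz: "1 - cnj l * \<phi> z \<noteq> 0" if "norm z < 1" for z
    using moebius_denom_nonzero(2)[OF l \<phi>1[OF that]] .
  have "\<psi> holomorphic_on ball 0 1"
    unfolding \<psi>_def using \<phi>(1) dnz by (intro holomorphic_intros) auto
  moreover have "\<psi> 0 = 0" by (simp add: \<psi>_def \<phi>0)
  moreover have "norm (\<psi> z) < 1" if "norm z < 1" for z
  proof -
    have "\<psi> z = delta (\<phi> z) (- l)" by (simp add: \<psi>_def delta_def)
    then show ?thesis using norm_delta_less_1[of "- l" "\<phi> z"] l \<phi>1[OF that] by simp
  qed
  ultimately obtain \<eta> where \<eta>: "\<eta> holomorphic_on ball 0 1" "\<forall>z\<in>ball 0 1. \<psi> z = z * \<eta> z"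
     "(\<forall>z\<in>ball 0 1. norm (\<eta> z) < 1) \<or> (\<exists>c. norm c = 1 \<and> (\<forall>z\<in>ball 0 1. \<eta> z = c))"
    using Schwarz_quotient[of \<psi>] by blast
  have "g z = 2 * of_real M * (z * \<eta> z + l) / kernel_denom l z (z * \<eta> z)" if z: "norm z < 1" for z
  proof -
    define D where "D = 1 - cnj l * \<phi> z"
    have D: "D \<noteq> 0" using dnz[OF z] by (simp add: D_def)
    have \<psi>D: "\<psi> z * D = \<phi> z - l" using D by (simp add: \<psi>_def D_def)
    have ll: "1 - l * cnj l \<noteq> 0"
      using moebius_denom_nonzero(2)[OF l l] by (simp add: mult.commute)
    have n: "(\<psi> z + l) * D = (1 - l * cnj l) * \<phi> z"
      using \<psi>D by (simp add: distrib_right) (simp add: D_def algebra_simps)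
    have "kernel_denom l z (\<psi> z) * D = (1 - l * z) * D + (cnj l - z) * (\<psi> z * D)"
      by (simp add: kernel_denom_def algebra_simps)
    also have "\<dots> = (1 - l * cnj l) * (1 - z * \<phi> z)"
      unfolding \<psi>D by (simp add: D_def algebra_simps)
    finally have d: "kernel_denom l z (\<psi> z) * D = (1 - l * cnj l) * (1 - z * \<phi> z)" .
    have \<phi>W: "\<phi> z * W z = g z" using \<phi>g[of z] Wnz[OF z] z by (auto simp: divide_simps)
    have "(1 - z * \<phi> z) * W z = W z - z * (\<phi> z * W z)" by (simp add: algebra_simps)
    also have "\<dots> = 2 * of_real M" unfolding \<phi>W by (simp add: W_def)
    finally have e: "(1 - z * \<phi> z) * W z = 2 * of_real M" .
    then have nz: "1 - z * \<phi> z \<noteq> 0" using M by auto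
    have "2 * of_real M * (\<psi> z + l) / kernel_denom l z (\<psi> z)
        = 2 * of_real M * ((\<psi> z + l) * D) / (kernel_denom l z (\<psi> z) * D)"
      using D by simp
    also have "\<dots> = 2 * of_real M * \<phi> z / (1 - z * \<phi> z)"
      unfolding n d using ll by simp
    also have "\<dots> = g z"
      unfolding e[symmetric] using nz \<phi>W by (simp add: ac_simps)
    finally show ?thesis using \<eta>(2) z by simp
  qed
  then show ?thesis using \<eta> unfolding g_def by auto
qed

section \<open>The extremal functions\<close>

lemma linepath_integral_has_derivative:
  assumes h: "h holomorphic_on ball 0 1" and z: "z \<in> ball 0 1"
  shows "((\<lambda>z. contour_integral (linepath 0 z) h) has_field_derivative h z) (at z)"
proof -
  obtain F where F: "\<And>z. z \<in> ball 0 1 \<Longrightarrow> (F has_field_derivative h z) (at z within ball 0 1)"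
    using holomorphic_convex_primitive'[OF convex_ball open_ball h] by blast
  have I: "F y - F 0 = contour_integral (linepath 0 y) h" if y: "y \<in> ball 0 1" for y
  proof -
    have "path_image (linepath 0 y) \<subseteq> ball 0 1"
      using y by (auto simp: closed_segment_subset)
    then show ?thesis
      using contour_integral_primitive[OF F, of "linepath 0 y"] by (simp add: contour_integral_unique)
  qed
  have "((\<lambda>z. F z - F 0) has_field_derivative h z) (at z)"
    using F[OF z] at_within_open[OF z open_ball] by (auto intro!: derivative_eq_intros)
  then show ?thesis
    by (rule has_field_derivative_transform_within_open[OF _ open_ball z I])
qed

lemma H_integrand_eq:
  assumes "norm a = 1" "norm l < 1" "z \<in> ball 0 1"
  shows "H_integrand M a l z = 2 * of_real M * (a * z + l) / kernel_denom l z (a * z)"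
  unfolding H_integrand_def using assms by (intro delta_kernel) (auto simp: norm_mult)

lemma kernel_denom_rotation_nonzero:
  assumes "norm a = 1" "norm l < 1" "z \<in> ball 0 1"
  shows "kernel_denom l z (a * z) \<noteq> 0"
  using assms by (intro kernel_denom_nonzero) (auto simp: norm_mult)

lemma H_fun_derivs:
  assumes a: "norm a = 1" and l: "norm l < 1" and z: "z \<in> ball 0 1"
  shows "(H_fun \<alpha> M a l has_field_derivative
            contour_integral (linepath 0 z) (H_integrand M a l) + \<alpha>) (at z)"
    and "((\<lambda>z. contour_integral (linepath 0 z) (H_integrand M a l) + \<alpha>) has_field_derivative
            H_integrand M a l z) (at z)"
proof -
  have "(\<lambda>z. 2 * of_real M * (a * z + l) / kernel_denom l z (a * z)) holomorphic_on ball 0 1"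
    using kernel_denom_rotation_nonzero[OF a l]
    unfolding kernel_denom_def by (intro holomorphic_intros) auto
  then have h: "H_integrand M a l holomorphic_on ball 0 1"
    by (rule holomorphic_transform) (simp add: H_integrand_eq[OF a l])
  note I = linepath_integral_has_derivative[OF h]
  have "(\<lambda>z. contour_integral (linepath 0 z) (H_integrand M a l)) holomorphic_on ball 0 1"
    unfolding holomorphic_on_open[OF open_ball] using I by blast
  from linepath_integral_has_derivative[OF this z]
  show "(H_fun \<alpha> M a l has_field_derivative
            contour_integral (linepath 0 z) (H_integrand M a l) + \<alpha>) (at z)"
    unfolding H_fun_def by (auto intro!: derivative_eq_intros)
  show "((\<lambda>z. contour_integral (linepath 0 z) (H_integrand M a l) + \<alpha>) has_field_derivative
            H_integrand M a l z) (at z)"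
    using I[OF z] by (auto intro!: derivative_eq_intros)
qed

lemma deriv_H_fun:
  assumes a: "norm a = 1" and l: "norm l < 1" and z: "z \<in> ball 0 1"
  shows "deriv (H_fun \<alpha> M a l) z = contour_integral (linepath 0 z) (H_integrand M a l) + \<alpha>"
    and "deriv (deriv (H_fun \<alpha> M a l)) z = H_integrand M a l z"
proof -
  note * = class_S2_iff_primitives(2,3)[where f = "H_fun \<alpha> M a l" and f'' = "H_integrand M a l"
      and f' = "\<lambda>z. contour_integral (linepath 0 z) (H_integrand M a l) + \<alpha>"]
  show "deriv (H_fun \<alpha> M a l) z = contour_integral (linepath 0 z) (H_integrand M a l) + \<alpha>"
    by (rule *(1)) (use H_fun_derivs[OF a l] z in blast)+
  show "deriv (deriv (H_fun \<alpha> M a l)) z = H_integrand M a l z"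
    by (rule *(2)) (use H_fun_derivs[OF a l] z in blast)+
qed

lemma H_fun_in_class_S2:
  assumes a: "norm a = 1" and l: "norm l < 1" and M: "0 < M"
  shows "H_fun \<alpha> M a l \<in> class_S2 \<alpha> M l"
proof -
  have "Re (z * H_integrand M a l z) > - M" if z: "z \<in> ball 0 1" for z
  proof -
    define \<omega> where "\<omega> = delta (a * z) l * z"
    have "norm (delta (a * z) l) < 1"
      using a l z by (intro norm_delta_less_1) (auto simp: norm_mult)
    then have \<omega>: "norm \<omega> < 1"
      unfolding \<omega>_def using mult_strict_mono'[of "norm (delta (a * z) l)" 1 "norm z" 1] z
      by (simp add: norm_mult)
    then have nz: "1 - \<omega> \<noteq> 0" by auto
    have "Re ((1 + \<omega>) * cnj (1 - \<omega>)) = 1 - (norm \<omega>)\<^sup>2"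
      unfolding cmod_power2 by (simp add: power2_eq_square algebra_simps)
    also have "\<dots> > 0" using \<omega> by (simp add: power_less_one_iff)
    finally have "0 < M * Re ((1 + \<omega>) / (1 - \<omega>))"
      using Re_divide_pos M by (intro mult_pos_pos) auto
    also have "\<dots> = Re (of_real M * ((1 + \<omega>) / (1 - \<omega>)))"
      by (simp only: Re_complex_of_real Im_complex_of_real times_complex.sel mult_zero_left diff_zero)
    also have "of_real M * ((1 + \<omega>) / (1 - \<omega>)) = z * H_integrand M a l z + of_real M"
      unfolding H_integrand_def \<omega>_def[symmetric] using nz
      by (simp add: divide_simps) (simp add: \<omega>_def algebra_simps)
    finally show ?thesis by simp
  qed
  moreover have "H_integrand M a l 0 = 2 * of_real M * l"
    by (simp add: H_integrand_def delta_def)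
  ultimately show ?thesis
    using class_S2_iff_primitives(1)[where f = "H_fun \<alpha> M a l" and f'' = "H_integrand M a l"
        and f' = "\<lambda>z. contour_integral (linepath 0 z) (H_integrand M a l) + \<alpha>", of \<alpha> M l]
      H_fun_derivs[OF a l] by (simp add: H_fun_def)
qed

text \<open>One point different from the origin suffices, since the kernel is injective in its rotation argument.\<close>
lemma H_integrand_inject:
  assumes "norm a = 1" "norm b = 1" and l: "norm l < 1" and M: "0 < M"
    and eq: "\<And>z. z \<in> ball 0 1 \<Longrightarrow> H_integrand M a l z = H_integrand M b l z"
  shows "a = b"
proof -
  define z :: complex where "z = 1/2"
  have z: "z \<in> ball 0 1" "z \<noteq> 0" by (auto simp: z_def)
  have nz: "kernel_denom l z (z * a) \<noteq> 0" "kernel_denom l z (z * b) \<noteq> 0"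
    using kernel_denom_rotation_nonzero[OF assms(1) l z(1)]
      kernel_denom_rotation_nonzero[OF assms(2) l z(1)] by (simp_all add: mult.commute)
  have "(norm l)\<^sup>2 < 1" using l by (simp add: power_less_one_iff)
  then have "2 * M * (1 - (norm l)\<^sup>2) \<noteq> 0" using M by auto
  then show ?thesis
    using kernel_difference[OF nz, of M] eq[OF z(1)] z nz
      H_integrand_eq[OF assms(1) l z(1), of M] H_integrand_eq[OF assms(2) l z(1), of M]
    by (auto simp add: mult.commute simp del: of_real_mult of_real_diff of_real_power)
qed

section \<open>Supporting lines at the extremal values\<close>

text \<open>Unless \<open>f''\<close> is the extremal second derivative, its parameter \<open>\<eta>\<close> avoids the value \<open>a\<close> everywhere in the disc.
  Then, by strict convexity of the discs of values (\<open>Re_chord_pos\<close>), the quotient of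
  \<open>H'' - f''\<close> by the derivative of the starlike comparison function has positive real part at every point, and
  \<open>Re_quotient_pos_of_derivative_quotient\<close> passes this on to the primitives. So \<open>\<kappa>\<close>, the reciprocal of the
  comparison function at \<open>z0\<close>, defines a line that supports the region of variability at the extremal
  value and touches it only there.\<close>
lemma extremal_function_support:
  assumes a: "norm a = 1" and l: "norm l < 1" and M: "0 < M"
    and z0: "z0 \<in> ball 0 1" "z0 \<noteq> 0"
  shows "\<exists>\<kappa>. \<kappa> \<noteq> 0 \<and> (\<forall>f\<in>class_S2 \<alpha> M l.
           (\<forall>z\<in>ball 0 1. deriv (deriv f) z = H_integrand M a l z) \<or>
           0 < Re (\<kappa> * (deriv (H_fun \<alpha> M a l) z0 - deriv f z0)))"
proof -
  define Q where "Q z = kernel_denom l z (a * z)" for z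
  obtain G where G: "G holomorphic_on ball 0 1"
    "\<And>z. z \<in> ball 0 1 \<Longrightarrow> 2 * G z + z * deriv G z = a / (Q z)\<^sup>2"
    "\<And>z. z \<in> ball 0 1 \<Longrightarrow> 0 < Re (G z / (a / (Q z)\<^sup>2))"
    using starlike_comparison_function[OF a l] unfolding Q_def by blast
  have Gz0: "G z0 \<noteq> 0" using G(3)[OF z0(1)] by auto
  have Qnz: "Q z \<noteq> 0" if "z \<in> ball 0 1" for z
    using kernel_denom_rotation_nonzero[OF a l that] by (simp add: Q_def)
  have anz: "a \<noteq> 0" using a by auto
  have "0 < Re (1 / (z0\<^sup>2 * G z0) * (deriv (H_fun \<alpha> M a l) z0 - deriv f z0))"
    if f: "f \<in> class_S2 \<alpha> M l"
      and ne: "\<not> (\<forall>z\<in>ball 0 1. deriv (deriv f) z = H_integrand M a l z)" for f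
  proof -
    obtain \<eta> where \<eta>: "\<eta> holomorphic_on ball 0 1"
      "(\<forall>z\<in>ball 0 1. norm (\<eta> z) < 1) \<or> (\<exists>c. norm c = 1 \<and> (\<forall>z\<in>ball 0 1. \<eta> z = c))"
      "\<forall>z\<in>ball 0 1. deriv (deriv f) z = 2 * of_real M * (z * \<eta> z + l) / kernel_denom l z (z * \<eta> z)"
      using class_S2_second_deriv[OF f M l] by blast
    have "deriv (deriv f) z = H_integrand M a l z" if "\<eta> z = a" "z \<in> ball 0 1" for z
      using \<eta>(3) that H_integrand_eq[OF a l that(2), of M] by (simp add: mult.commute)
    with ne have "\<not> (\<forall>z\<in>ball 0 1. \<eta> z = a)" by blast
    then have \<eta>1: "norm (\<eta> z) \<le> 1 \<and> \<eta> z \<noteq> a" if "z \<in> ball 0 1" for z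
      using \<eta>(2) a that by force
    define K where "K z = kernel_denom l z (z * \<eta> z)" for z
    have Knz: "K z \<noteq> 0" if "z \<in> ball 0 1" for z
      unfolding K_def using that l \<eta>1[OF that] mult_mono[of "norm z" 1 "norm (\<eta> z)" 1]
      by (intro kernel_denom_nonzero) (auto simp: norm_mult)
    define c where "c = 2 * M * (1 - (norm l)\<^sup>2)"
    have c: "c > 0" using l M by (auto simp: c_def power_less_one_iff)
    define s where "s z = of_real c * (a - \<eta> z) / (Q z * K z)" for z
    have Qh: "Q holomorphic_on ball 0 1"
      unfolding Q_def kernel_denom_def by (intro holomorphic_intros)
    have Kh: "K holomorphic_on ball 0 1"
      unfolding K_def kernel_denom_def using \<eta>(1) by (intro holomorphic_intros)
    have sh: "s holomorphic_on ball 0 1"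
      unfolding s_def using Qh Kh \<eta>(1) Qnz Knz by (intro holomorphic_intros) auto
    have d2: "H_integrand M a l z - deriv (deriv f) z = z * s z" if z: "z \<in> ball 0 1" for z
      using kernel_difference[of l z a "\<eta> z" M] Qnz[OF z] Knz[OF z] \<eta>(3) z
        H_integrand_eq[OF a l z, of M]
      unfolding s_def Q_def K_def c_def by (simp only: mult.commute[of a z] if_True simp_thms)
    define P where "P z = deriv (H_fun \<alpha> M a l) z - deriv f z" for z
    have dP: "(P has_field_derivative z * s z) (at z)" if z: "z \<in> ball 0 1" for z
      using DERIV_diff[OF class_S2_derivs(2)[OF H_fun_in_class_S2[OF a l M] z]
          class_S2_derivs(2)[OF f z]]
      unfolding P_def d2[OF z, symmetric] deriv_H_fun(2)[OF a l z] .
    have P0: "P 0 = 0"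
      using f H_fun_in_class_S2[OF a l M, of \<alpha>]
      by (simp add: P_def class_S2_def class_P_def)
    have "\<exists>R. R holomorphic_on ball 0 1 \<and>
           (\<forall>z\<in>ball 0 1. P z = z\<^sup>2 * R z \<and> 2 * R z + z * deriv R z = s z)"
      by (rule double_zero_factorization[of P s]) (use dP P0 sh in auto)
    then obtain R where R: "R holomorphic_on ball 0 1"
      and R_eq: "\<forall>z\<in>ball 0 1. P z = z\<^sup>2 * R z \<and> 2 * R z + z * deriv R z = s z"
      by (elim exE conjE)
    have "0 < Re (s z / (a / (Q z)\<^sup>2))" if z: "z \<in> ball 0 1" for z
    proof -
      \<comment> \<open>The normalization \<open>\<omega> = \<eta> z / a\<close> puts the extremal value at \<open>\<omega> = 1\<close>; \<open>X\<close> and \<open>Y\<close> are the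
        coefficients of the kernel denominator, and \<open>\<bar>Y\<bar> < \<bar>X\<bar>\<close> by \<open>norm_kernel_coeff_less\<close>.\<close>
      define X where "X = 1 - l * z"
      define Y where "Y = (cnj l - z) * (a * z)"
      define \<omega> where "\<omega> = \<eta> z / a"
      have XY: "X + Y = Q z" by (simp add: X_def Y_def Q_def kernel_denom_def)
      have "Y * \<omega> = (cnj l - z) * (z * \<eta> z)" using anz by (simp add: Y_def \<omega>_def)
      then have XY\<omega>: "X + Y * \<omega> = K z" by (simp add: X_def K_def kernel_denom_def)
      have "norm Y \<le> norm (cnj l - z) * 1"
        unfolding Y_def norm_mult using a z by (intro mult_left_mono) auto
      also have "\<dots> < norm X"
        using norm_kernel_coeff_less[OF l, of z] z by (simp add: X_def)
      finally have "norm Y < norm X" .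
      moreover have "norm \<omega> \<le> 1" "\<omega> \<noteq> 1"
        using \<eta>1[OF z] a anz by (auto simp: \<omega>_def norm_divide)
      ultimately have "0 < c * Re ((1 - \<omega>) * (X + Y) / (X + Y * \<omega>))"
        using c Re_chord_pos by (intro mult_pos_pos)
      also have "\<dots> = Re (of_real c * ((1 - \<omega>) * (X + Y) / (X + Y * \<omega>)))"
        by (simp only: Re_complex_of_real Im_complex_of_real times_complex.sel mult_zero_left diff_zero)
      also have "of_real c * ((1 - \<omega>) * (X + Y) / (X + Y * \<omega>)) = s z / (a / (Q z)\<^sup>2)"
      proof -
        have "(1 - \<omega>) = (a - \<eta> z) / a" using anz by (simp add: \<omega>_def diff_divide_distrib)
        then show ?thesis unfolding XY XY\<omega> s_def using anz Qnz[OF z] Knz[OF z]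
          by (simp add: power2_eq_square)
      qed
      finally show ?thesis .
    qed
    then have "0 < Re (R z0 / G z0)"
      using Re_quotient_pos_of_derivative_quotient[OF G(1) R _ _ z0(1)] G(2,3) R_eq by simp
    also have "R z0 / G z0 = 1 / (z0\<^sup>2 * G z0) * P z0"
      using R_eq z0 Gz0 by simp
    finally show ?thesis unfolding P_def .
  qed
  moreover have "1 / (z0\<^sup>2 * G z0) \<noteq> 0" using Gz0 z0 by simp
  ultimately show ?thesis by blast
qed

section \<open>The region of variability and its boundary\<close>

lemma convex_V2:
  assumes z0: "z0 \<in> ball 0 1"
  shows "convex (V2 \<alpha> M z0 l)"
proof (rule convexI)
  fix x y :: complex and u v :: real
  assume xy: "x \<in> V2 \<alpha> M z0 l" "y \<in> V2 \<alpha> M z0 l" and uv: "0 \<le> u" "0 \<le> v" "u + v = 1"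
  obtain f g where f: "f \<in> class_S2 \<alpha> M l" "x = deriv f z0"
    and g: "g \<in> class_S2 \<alpha> M l" "y = deriv g z0"
    using xy by (auto simp: V2_def)
  define h where "h z = of_real u * f z + of_real v * g z" for z
  define h' where "h' z = of_real u * deriv f z + of_real v * deriv g z" for z
  define h'' where "h'' z = of_real u * deriv (deriv f) z + of_real v * deriv (deriv g) z" for z
  have D: "(h has_field_derivative h' z) (at z)" "(h' has_field_derivative h'' z) (at z)"
    if "z \<in> ball 0 1" for z
    using class_S2_derivs[OF f(1) that] class_S2_derivs[OF g(1) that]
    unfolding h_def h'_def h''_def by (auto intro!: DERIV_add DERIV_cmult)
  have fP: "f 0 = 0" "deriv f 0 = \<alpha>" "deriv (deriv f) 0 = 2 * of_real M * l"
    "\<And>z. z \<in> ball 0 1 \<Longrightarrow> Re (z * deriv (deriv f) z) > - M"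
    using f(1) by (auto simp: class_S2_def class_P_def)
  have gP: "g 0 = 0" "deriv g 0 = \<alpha>" "deriv (deriv g) 0 = 2 * of_real M * l"
    "\<And>z. z \<in> ball 0 1 \<Longrightarrow> Re (z * deriv (deriv g) z) > - M"
    using g(1) by (auto simp: class_S2_def class_P_def)
  have uv1: "of_real u + of_real v = (1::complex)"
    using uv(3) by (metis of_real_1 of_real_add)
  have "Re (z * h'' z) > - M" if "z \<in> ball 0 1" for z
  proof -
    have "z * h'' z = of_real u * (z * deriv (deriv f) z) + of_real v * (z * deriv (deriv g) z)"
      by (simp add: h''_def algebra_simps)
    then have "Re (z * h'' z) = u * Re (z * deriv (deriv f) z) + v * Re (z * deriv (deriv g) z)"
      by (simp only: plus_complex.sel Re_complex_of_real Im_complex_of_real times_complex.sel[of "of_real _"]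
          mult_zero_left diff_zero)
    moreover have "u * - Re (z * deriv (deriv f) z) + v * - Re (z * deriv (deriv g) z) < M"
      using fP(4)[OF that] gP(4)[OF that] uv by (intro convex_bound_lt) linarith+
    ultimately show ?thesis by (simp only: mult_minus_right)
  qed
  moreover have "h 0 = 0" by (simp add: h_def fP gP)
  moreover have "h' 0 = \<alpha>" "h'' 0 = 2 * of_real M * l"
    unfolding h'_def h''_def fP gP distrib_right[symmetric] uv1 by simp_all
  ultimately have "h \<in> class_S2 \<alpha> M l"
    using class_S2_iff_primitives(1)[where f = h and f' = h' and f'' = h'', OF D] by blast
  moreover have "deriv h z0 = u *\<^sub>R x + v *\<^sub>R y"
    using class_S2_iff_primitives(2)[where f = h and f' = h' and f'' = h'', OF D z0]
    by (simp add: h'_def f g scaleR_conv_of_real)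
  ultimately show "u *\<^sub>R x + v *\<^sub>R y \<in> V2 \<alpha> M z0 l"
    unfolding V2_def by (metis (mono_tags, lifting) mem_Collect_eq)
qed

text \<open>A convex set cannot have more boundary than one loop in it: the inside of the loop lies in
  the convex set, and the interior of the set, being connected and disjoint from the loop, cannot leave
  the inside.\<close>
lemma frontier_convex_eq_simple_loop:
  fixes p :: "real \<Rightarrow> complex"
  assumes V: "convex V" and p: "simple_path p" "pathfinish p = pathstart p"
    and sub: "path_image p \<subseteq> V" and fr: "path_image p \<inter> interior V = {}"
  shows "frontier V = path_image p"
proof -
  note J = Jordan_inside_outside[OF p]
  have in_V: "inside (path_image p) \<subseteq> V"
    using outside_subset_convex[OF V sub] inside_Int_outside[of "path_image p"] by blast
  then have in_int: "inside (path_image p) \<subseteq> interior V"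
    using J by (intro interior_maximal) auto
  have "interior V \<subseteq> inside (path_image p)"
  proof (rule ccontr)
    assume "\<not> ?thesis"
    then have "outside (path_image p) \<inter> interior V \<noteq> {}"
      using fr inside_Un_outside[of "path_image p"] by blast
    moreover have "inside (path_image p) \<inter> interior V \<noteq> {}" using in_int J by blast
    moreover have "connected (interior V)" using V by (intro convex_connected convex_interior)
    ultimately show False
      using inside_outside_intersect_connected fr by blast
  qed
  with in_int have eq: "interior V = inside (path_image p)" by blast
  then have "interior V \<noteq> {}" using J by simp
  then have "frontier V = frontier (interior V)"
    using convex_closure_interior[OF V] by (simp add: frontier_def)
  then show ?thesis using eq J by simp
qed

text \<open>Parametrizing the segment turns this into the continuity of an integral with respect to a parameter.\<close>
lemma continuous_H_endpoint:
  assumes l: "norm l < 1" and z0: "z0 \<in> ball 0 1"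
  shows "continuous_on UNIV (\<lambda>\<theta>. contour_integral (linepath 0 z0) (H_integrand M (cis \<theta>) l))"
proof -
  define h where "h \<theta> x = 2 * of_real M * (cis \<theta> * (of_real x * z0) + l)
      / kernel_denom l (of_real x * z0) (cis \<theta> * (of_real x * z0)) * z0" for \<theta> x :: real
  have xz: "of_real x * z0 \<in> ball 0 1" if "x \<in> {0..1}" for x :: real
    using z0 that mult_left_le_one_le[of "norm z0" x] by (auto simp: norm_mult)
  have "continuous_on (UNIV \<times> cbox 0 1) (\<lambda>(\<theta>, x). h \<theta> x)"
    using kernel_denom_rotation_nonzero[OF norm_cis l xz]
    unfolding h_def split_def kernel_denom_def
    by (intro continuous_intros) auto
  then have "continuous_on UNIV (\<lambda>\<theta>. integral (cbox 0 1) (h \<theta>))"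
    by (rule integral_continuous_on_param)
  moreover have "integral (cbox 0 1) (h \<theta>) = contour_integral (linepath 0 z0) (H_integrand M (cis \<theta>) l)" for \<theta>
    unfolding contour_integral_integral box_real
    by (rule integral_cong)
       (simp add: H_integrand_eq[OF norm_cis l xz] linepath_def scaleR_conv_of_real h_def)
  ultimately show ?thesis by simp
qed

lemma cis_eq_cis_iff: "cis s = cis t \<longleftrightarrow> (\<exists>n::int. s = t + 2 * pi * of_int n)"
proof -
  have "cis s = cis t \<longleftrightarrow> (\<exists>n::int. \<i> * of_real s = \<i> * of_real t + complex_of_real (of_int (2 * n) * pi) * \<i>)"
    unfolding cis_conv_exp exp_eq ..
  also have "\<dots> \<longleftrightarrow> (\<exists>n::int. s = t + 2 * pi * of_int n)"
    by (simp add: complex_eq_iff ac_simps)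
  finally show ?thesis .
qed

lemma class_S2_eqI:
  assumes f: "f \<in> class_S2 \<alpha> M l" and g: "g \<in> class_S2 \<alpha> M l"
    and eq: "\<And>z. z \<in> ball 0 1 \<Longrightarrow> deriv (deriv f) z = deriv (deriv g) z"
    and z: "z \<in> ball 0 1"
  shows "f z = g z"
proof -
  have const: "u z = u 0" if "\<And>z. z \<in> ball 0 1 \<Longrightarrow> (u has_field_derivative 0) (at z)"
      "z \<in> ball 0 1" for u :: "complex \<Rightarrow> complex" and z
    using has_field_derivative_zero_constant[OF convex_ball, of 0 1 u]
      has_field_derivative_at_within[OF that(1)] that(2)
    by (metis centre_in_ball zero_less_one)
  have "deriv f z - deriv g z = deriv f 0 - deriv g 0" if z: "z \<in> ball 0 1" for z
    by (rule const[OF _ z]) (use DERIV_diff[OF class_S2_derivs(2)[OF f] class_S2_derivs(2)[OF g]] eq in fastforce)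
  moreover have "f 0 = g 0" "deriv f 0 = deriv g 0"
    using f g by (auto simp: class_S2_def class_P_def)
  ultimately have eq1: "deriv f z = deriv g z" if "z \<in> ball 0 1" for z
    using that by simp
  have "f z - g z = f 0 - g 0"
    by (rule const[OF _ z]) (use DERIV_diff[OF class_S2_derivs(1)[OF f] class_S2_derivs(1)[OF g]] eq1 in fastforce)
  then show ?thesis using \<open>f 0 = g 0\<close> by simp
qed

theorem theorem2p12:
  fixes \<alpha> l z0 :: complex and M :: real
  assumes "\<alpha> \<noteq> 0"
    and "0 < M" and "M \<le> 1 / ln 4"
    and "l \<in> ball 0 1"
    and "z0 \<in> ball 0 1 - {0}"
  defines "\<gamma> \<equiv> \<lambda>\<theta>::real. deriv (H_fun \<alpha> M (cis \<theta>) l) z0"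
  defines "p \<equiv> \<lambda>t::real. \<gamma> (2 * pi * t - pi)"
  shows "(\<forall>\<theta>\<in>{-pi<..pi}. \<gamma> \<theta> =
            contour_integral (linepath 0 z0)
              (\<lambda>\<zeta>. 2 * of_real M * delta (cis \<theta> * \<zeta>) l / (1 - delta (cis \<theta> * \<zeta>) l * \<zeta>)) + \<alpha>)
       \<and> simple_path p \<and> pathfinish p = pathstart p
       \<and> frontier (V2 \<alpha> M z0 l) = path_image p
       \<and> frontier (V2 \<alpha> M z0 l) = \<gamma> ` {-pi<..pi}
       \<and> (\<forall>f\<in>class_S2 \<alpha> M l. \<forall>\<theta>\<in>{-pi<..pi}.
            deriv f z0 = \<gamma> \<theta> \<longrightarrow> (\<forall>z\<in>ball 0 1. f z = H_fun \<alpha> M (cis \<theta>) l z))"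
proof -
  have M: "0 < M" and l: "norm l < 1" and z0: "z0 \<in> ball 0 1" "z0 \<noteq> 0"
    using assms by auto
  have \<gamma>_eq: "\<gamma> \<theta> = contour_integral (linepath 0 z0) (H_integrand M (cis \<theta>) l) + \<alpha>" for \<theta>
    unfolding \<gamma>_def by (rule deriv_H_fun(1)[OF norm_cis l z0(1)])
  have mem: "H_fun \<alpha> M (cis \<theta>) l \<in> class_S2 \<alpha> M l" for \<theta>
    by (rule H_fun_in_class_S2[OF norm_cis l M])
  have d2H: "deriv (deriv (H_fun \<alpha> M (cis \<theta>) l)) z = H_integrand M (cis \<theta>) l z"
    if "z \<in> ball 0 1" for \<theta> z
    by (rule deriv_H_fun(2)[OF norm_cis l that])
  have unique: "deriv (deriv f) z = H_integrand M (cis \<theta>) l z"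
    if "f \<in> class_S2 \<alpha> M l" "deriv f z0 = \<gamma> \<theta>" "z \<in> ball 0 1" for f \<theta> z
    using extremal_function_support[OF norm_cis l M z0, of \<alpha> \<theta>] that unfolding \<gamma>_def by force
  \<comment> \<open>Equal endpoints force equal second derivatives, hence equal rotations.\<close>
  have \<gamma>_inj: "\<exists>n::int. s = t + 2 * pi * of_int n" if "\<gamma> s = \<gamma> t" for s t
  proof -
    have "H_integrand M (cis s) l z = H_integrand M (cis t) l z" if z: "z \<in> ball 0 1" for z
      using unique[OF mem[of s] _ z, of t] d2H[OF z, of s] \<open>\<gamma> s = \<gamma> t\<close> by (simp add: \<gamma>_def)
    then have "cis s = cis t" using H_integrand_inject[OF norm_cis norm_cis l M] by blast
    then show ?thesis by (simp add: cis_eq_cis_iff)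
  qed
  have \<gamma>_per: "\<gamma> (- pi) = \<gamma> pi" by (simp add: \<gamma>_def cis.ctr)
  have "path p"
    unfolding path_def p_def \<gamma>_eq
    by (intro continuous_intros continuous_on_compose2[OF continuous_H_endpoint[OF l z0(1)]]) auto
  moreover have "loop_free p"
    unfolding loop_free_def
  proof (intro ballI impI)
    fix x y :: real
    assume xy: "x \<in> {0..1}" "y \<in> {0..1}" "p x = p y"
    obtain n :: int where "2 * pi * x - pi = 2 * pi * y - pi + 2 * pi * of_int n"
      using \<gamma>_inj xy(3) unfolding p_def by blast
    then have "2 * pi * x = 2 * pi * (y + of_int n)" by (simp add: algebra_simps)
    then have n: "x = y + of_int n" by simp
    then have "\<bar>real_of_int n\<bar> \<le> 1" using xy by auto
    then have "n = -1 \<or> n = 0 \<or> n = 1" by linarith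
    then show "x = y \<or> x = 0 \<and> y = 1 \<or> x = 1 \<and> y = 0" using n xy by auto
  qed
  ultimately have simple: "simple_path p" by (simp add: simple_path_def)
  have closed: "pathfinish p = pathstart p"
    using \<gamma>_per by (simp add: pathfinish_def pathstart_def p_def)
  have \<gamma>V: "\<gamma> \<theta> \<in> V2 \<alpha> M z0 l" for \<theta> unfolding V2_def \<gamma>_def using mem by blast
  have \<gamma>int: "\<gamma> \<theta> \<notin> interior (V2 \<alpha> M z0 l)" for \<theta>
  proof -
    obtain \<kappa> where \<kappa>: "\<kappa> \<noteq> 0" "\<And>f. f \<in> class_S2 \<alpha> M l \<Longrightarrow>
        (\<forall>z\<in>ball 0 1. deriv (deriv f) z = H_integrand M (cis \<theta>) l z) \<or> 0 < Re (\<kappa> * (\<gamma> \<theta> - deriv f z0))"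
      using extremal_function_support[OF norm_cis l M z0, of \<alpha> \<theta>] unfolding \<gamma>_def by blast
    have "Re (\<kappa> * v) \<le> Re (\<kappa> * \<gamma> \<theta>)" if v: "v \<in> V2 \<alpha> M z0 l" for v
    proof -
      obtain f where f: "f \<in> class_S2 \<alpha> M l" "v = deriv f z0" using v by (auto simp: V2_def)
      show ?thesis
      proof (cases "\<forall>z\<in>ball 0 1. deriv (deriv f) z = H_integrand M (cis \<theta>) l z")
        case True
        then have "f z = H_fun \<alpha> M (cis \<theta>) l z" if "z \<in> ball 0 1" for z
          using class_S2_eqI[OF f(1) mem _ that] d2H by simp
        then have "deriv f z0 = \<gamma> \<theta>"
          unfolding \<gamma>_def using z0(1)
          by (intro deriv_cong_ev) (auto simp: eventually_nhds intro!: exI[of _ "ball 0 1"])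
        then show ?thesis using f by simp
      next
        case False
        then have "0 < Re (\<kappa> * (\<gamma> \<theta> - deriv f z0))" using \<kappa>(2)[OF f(1)] by blast
        then show ?thesis using f(2) by (simp add: right_diff_distrib)
      qed
    qed
    then have "V2 \<alpha> M z0 l \<subseteq> {v. cnj \<kappa> \<bullet> v \<le> Re (\<kappa> * \<gamma> \<theta>)}"
      by (auto simp: inner_complex_def)
    then have "interior (V2 \<alpha> M z0 l) \<subseteq> interior {v. cnj \<kappa> \<bullet> v \<le> Re (\<kappa> * \<gamma> \<theta>)}"
      by (rule interior_mono)
    also have "\<dots> = {v. cnj \<kappa> \<bullet> v < Re (\<kappa> * \<gamma> \<theta>)}"
      using \<kappa>(1) by (intro interior_halfspace_le) simp
    finally have "interior (V2 \<alpha> M z0 l) \<subseteq> {v. cnj \<kappa> \<bullet> v < Re (\<kappa> * \<gamma> \<theta>)}" .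
    then show ?thesis by (auto simp: inner_complex_def)
  qed
  \<comment> \<open>The two ends of the parameter interval give the same point, so one of them can be dropped.\<close>
  have image: "path_image p = \<gamma> ` {-pi<..pi}"
  proof -
    have "(\<lambda>t. 2 * pi * t - pi) ` {0..1} = {-pi..pi}"
      using image_affinity_atLeastAtMost_diff[of "2 * pi" pi 0 1] by simp
    moreover have "path_image p = \<gamma> ` (\<lambda>t. 2 * pi * t - pi) ` {0..1}"
      unfolding path_image_def p_def image_image ..
    ultimately have "path_image p = \<gamma> ` {-pi..pi}" by simp
    also have "{-pi..pi} = insert (-pi) {-pi<..pi}" by auto
    also have "\<gamma> ` insert (-pi) {-pi<..pi} = \<gamma> ` {-pi<..pi}"
      using \<gamma>_per by auto
    finally show ?thesis .
  qed
  have frontier: "frontier (V2 \<alpha> M z0 l) = path_image p"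
    by (rule frontier_convex_eq_simple_loop[OF convex_V2[OF z0(1)] simple closed])
       (use image \<gamma>V \<gamma>int in auto)
  have "f z = H_fun \<alpha> M (cis \<theta>) l z"
    if "f \<in> class_S2 \<alpha> M l" "deriv f z0 = \<gamma> \<theta>" "z \<in> ball 0 1" for f \<theta> z
    by (rule class_S2_eqI[OF that(1) mem _ that(3)]) (simp add: unique[OF that(1,2)] d2H)
  then show ?thesis
    using \<gamma>_eq simple closed frontier image
    unfolding H_integrand_def[abs_def] by simp
qed

end
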